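(* For every integer $n\geq 1$, the polynomial $$C_n(t)=\sum_{w}t^{\operatorname{cdes}(w)},$$ where the sum is over all words $w\in\{0,1\}^{2n}$ with exactly $n$ zeros and $n$ ones, has one simple zero at the origin and $n-1$ simple negative zeros.
   Context: For a word $w=w_1\cdots w_{2n}\in\{0,1\}^{2n}$, with indices taken modulo $2n$ (so $w_{2n+1}=w_1$), a cyclic descent is an index $i\in\{1,\dots,2n\}$ with $w_i=1$ and $w_{i+1}=0$; $\operatorname{cdes}(w)$ is the number of cyclic descents of $w$. (Such words encode northeast lattice paths from $(0,0)$ to $(n,n)$, with $0$ an east step and $1$ a north step.) *)

theory Defs
  imports Complex_Main "HOL-Computational_Algebra.Polynomial"
begin

text \<open>Letters are numbered from \<open>0\<close>, so the cyclic successor of position \<open>i\<close> is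
  \<open>(i + 1) mod length w\<close>.\<close>
definition cdes :: "nat list \<Rightarrow> nat" where
  "cdes w = card {i. i < length w \<and> w ! i = 1 \<and> w ! ((i + 1) mod length w) = 0}"

definition balanced_words :: "nat \<Rightarrow> nat list set" where
  "balanced_words n =
     {w. length w = 2 * n \<and> set w \<subseteq> {0, 1} \<and> count_list w 0 = n \<and> count_list w 1 = n}"

lemma finite_balanced_words: "finite (balanced_words n)"
  by (rule finite_subset[OF _ finite_lists_length_eq[of "{0, 1}" "2 * n"]])
     (auto simp: balanced_words_def)

definition cdes_poly :: "nat \<Rightarrow> real poly" where
  "cdes_poly n = (\<Sum>w\<in>balanced_words n. monom 1 (cdes w))"

end

theory Submission
  imports Defs
begin

text \<open>A word with \<open>k\<close> cyclic descents splits cyclically into \<open>k\<close> runs of each letter; counting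
  compositions gives \<open>C\<^sub>n(t) = 2 (\<Sum>k. (n choose k) ((n - 1) choose (k - 1)) t\<^sup>k)\<close>. With
  \<open>m = n - 1\<close>, Leibniz' rule shows that under \<open>t = x / (1 + x)\<close> this is, up to a factor
  \<open>(1 + x)\<^sup>n\<close> and a constant, the \<open>m\<close>-th derivative of \<open>x\<^sup>m\<^sup>+\<^sup>1 (1 + x)\<^sup>m\<close> (a Rodrigues formula:
  \<open>C\<^sub>n\<close> is a Jacobi polynomial in disguise). By repeated use of Rolle's theorem that derivative has
  \<open>m\<close> zeros in \<open>(-1, 0)\<close>, an interval which \<open>x / (1 + x)\<close> maps injectively to the negative
  reals. Together with the zero at the origin these exhaust the degree.\<close>

section \<open>Descents of words with prescribed content\<close>

fun des :: "nat list \<Rightarrow> nat" where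
  "des (x # y # xs) = of_bool (x = 1 \<and> y = 0) + des (y # xs)"
| "des _ = 0"

definition content_words :: "nat \<Rightarrow> nat \<Rightarrow> nat list set" where
  "content_words a b = {u. set u \<subseteq> {0, 1} \<and> count_list u 0 = a \<and> count_list u 1 = b}"

lemma length_content_words:
  assumes "u \<in> content_words a b"
  shows "length u = a + b"
proof -
  have "set u \<subseteq> {0, 1} \<Longrightarrow> length u = count_list u 0 + count_list u 1"
    by (induction u) auto
  then show ?thesis
    using assms by (auto simp: content_words_def)
qed

lemma finite_content_words [simp]: "finite (content_words a b)"
  by (rule finite_subset[OF _ finite_lists_length_eq[of "{0, 1}" "a + b"]])
     (auto simp: length_content_words, auto simp: content_words_def)

lemma content_words_rec:
  "content_words 0 0 = {[]}"
  "content_words (Suc a) 0 = (#) 0 ` content_words a 0"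
  "content_words 0 (Suc b) = (#) 1 ` content_words 0 b"
  "content_words (Suc a) (Suc b) =
     (#) 0 ` content_words a (Suc b) \<union> (#) 1 ` content_words (Suc a) b"
proof -
  have cases: "u \<in> content_words a b \<longleftrightarrow>
     (case u of [] \<Rightarrow> a = 0 \<and> b = 0
      | y # v \<Rightarrow> (y = 0 \<and> a > 0 \<and> v \<in> content_words (a - 1) b) \<or>
                (y = 1 \<and> b > 0 \<and> v \<in> content_words a (b - 1)))" for u a b
    by (cases u) (auto simp: content_words_def)
  show "content_words 0 0 = {[]}"
    "content_words (Suc a) 0 = (#) 0 ` content_words a 0"
    "content_words 0 (Suc b) = (#) 1 ` content_words 0 b"
    "content_words (Suc a) (Suc b) =
     (#) 0 ` content_words a (Suc b) \<union> (#) 1 ` content_words (Suc a) b"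
    by (auto simp: set_eq_iff cases[of _ 0 0] cases[of _ "Suc a" 0] cases[of _ 0 "Suc b"]
        cases[of _ "Suc a" "Suc b"] image_iff split: list.splits)
qed

text \<open>The letter \<open>x\<close> opens the word and \<open>c\<close> closes it. Keeping them
  independent lets the recursion consume letters on the left while \<open>c\<close> stays fixed;
  cyclic words are the case \<open>c = x\<close>.\<close>

definition des_poly :: "nat \<Rightarrow> nat \<Rightarrow> nat \<Rightarrow> nat \<Rightarrow> real poly" where
  "des_poly c x a b = (\<Sum>u\<in>content_words a b. monom 1 (des (x # u @ [c])))"

lemma sum_des_Cons:
  "(\<Sum>u\<in>(#) y ` content_words a b. monom 1 (des (x # u @ [c]))) =
     monom 1 (of_bool (x = 1 \<and> y = 0)) * des_poly c y a b"
  by (subst sum.reindex) (auto simp: des_poly_def sum_distrib_left mult_monom)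

lemma des_poly_rec:
  "des_poly c x 0 0 = monom 1 (of_bool (x = 1 \<and> c = 0))"
  "des_poly c x (Suc a) 0 = monom 1 (of_bool (x = 1)) * des_poly c 0 a 0"
  "des_poly c x 0 (Suc b) = des_poly c 1 0 b"
  "des_poly c x (Suc a) (Suc b) =
     monom 1 (of_bool (x = 1)) * des_poly c 0 a (Suc b) + des_poly c 1 (Suc a) b"
proof -
  show "des_poly c x 0 0 = monom 1 (of_bool (x = 1 \<and> c = 0))"
    by (simp add: des_poly_def content_words_rec)
  show "des_poly c x (Suc a) 0 = monom 1 (of_bool (x = 1)) * des_poly c 0 a 0"
    using sum_des_Cons[of x c 0 a 0] by (simp add: des_poly_def[of c x] content_words_rec)
  show "des_poly c x 0 (Suc b) = des_poly c 1 0 b"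
    using sum_des_Cons[of x c 1 0 b] by (simp add: des_poly_def[of c x] content_words_rec)
  show "des_poly c x (Suc a) (Suc b) =
     monom 1 (of_bool (x = 1)) * des_poly c 0 a (Suc b) + des_poly c 1 (Suc a) b"
    using sum_des_Cons[of x c 0 a "Suc b"] sum_des_Cons[of x c 1 "Suc a" b]
    by (subst des_poly_def, subst content_words_rec, subst sum.union_disjoint) auto
qed

lemma coeff_monom_1_1_mult:
  fixes p :: "'a :: comm_semiring_1 poly"
  shows "coeff (monom 1 (Suc 0) * p) 0 = 0" "coeff (monom 1 (Suc 0) * p) (Suc k) = coeff p k"
  by (simp_all add: coeff_monom_mult)

text \<open>Mirrors the branching of \<open>des_poly_rec\<close>, where removing the first letter
  lowers either count.\<close>

lemma content_induct [case_names zero_zero Suc_zero zero_Suc Suc_Suc]: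
  fixes P :: "nat \<Rightarrow> nat \<Rightarrow> bool"
  assumes "P 0 0"
    and "\<And>a. P a 0 \<Longrightarrow> P (Suc a) 0"
    and "\<And>b. P 0 b \<Longrightarrow> P 0 (Suc b)"
    and "\<And>a b. P a (Suc b) \<Longrightarrow> P (Suc a) b \<Longrightarrow> P (Suc a) (Suc b)"
  shows "P a b"
proof (induction a arbitrary: b)
  case 0
  show ?case by (induction b) (use assms in auto)
next
  case (Suc a)
  then show ?case by (induction b) (use assms in auto)
qed

text \<open>The recursion alternates between \<open>x = 0\<close> and \<open>x = 1\<close>, so both
  closed forms are proved at once, by Pascal's rule. They count compositions: for
  \<open>x = 0\<close> and \<open>k = Suc j\<close>, the \<open>a + 2\<close> zeros form
  \<open>j + 2\<close> runs and the \<open>b\<close> ones form \<open>j + 1\<close>.\<close>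

lemma coeff_des_poly_0:
  "coeff (des_poly 0 0 a b) k =
     (case k of 0 \<Rightarrow> of_bool (b = 0)
      | Suc j \<Rightarrow> if b = 0 then 0 else real (Suc a choose Suc j) * real ((b - 1) choose j)) \<and>
   coeff (des_poly 0 (Suc 0) a b) k =
     (case k of 0 \<Rightarrow> 0 | Suc j \<Rightarrow> real (a choose j) * real (b choose j))"
proof (induction a b arbitrary: k rule: content_induct)
  case zero_zero
  show ?case by (auto simp: des_poly_rec split: nat.splits)
next
  case (Suc_zero a)
  then show ?case
    by (cases k; cases "k - 1") (auto simp: des_poly_rec coeff_monom_1_1_mult)
next
  case (zero_Suc b)
  then show ?case
    by (cases k; cases "k - 1") (auto simp: des_poly_rec)
next
  case (Suc_Suc a b)
  then show ?case
    by (cases k; cases "k - 1")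
       (auto simp: des_poly_rec coeff_monom_1_1_mult algebra_simps)
qed

lemma coeff_des_poly_1:
  "coeff (des_poly (Suc 0) 0 a b) k = real (a choose k) * real (b choose k) \<and>
   coeff (des_poly (Suc 0) (Suc 0) a b) k =
     (case k of 0 \<Rightarrow> of_bool (a = 0)
      | Suc j \<Rightarrow> if a = 0 then 0 else real (Suc b choose Suc j) * real ((a - 1) choose j))"
proof (induction a b arbitrary: k rule: content_induct)
  case zero_zero
  show ?case by (cases k) (auto simp: des_poly_rec)
next
  case (Suc_zero a)
  then show ?case
    by (cases k; cases "k - 1") (auto simp: des_poly_rec coeff_monom_1_1_mult)
next
  case (zero_Suc b)
  then show ?case
    by (cases k; cases "k - 1") (auto simp: des_poly_rec)
next
  case (Suc_Suc a b)
  then show ?case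
    by (cases k; cases "k - 1")
       (auto simp: des_poly_rec coeff_monom_1_1_mult algebra_simps)
qed

lemma des_eq_card: "des xs = card {i. Suc i < length xs \<and> xs ! i = 1 \<and> xs ! Suc i = 0}"
proof (induction xs rule: des.induct)
  case (1 x y xs)
  let ?D = "\<lambda>zs. {i. Suc i < length zs \<and> zs ! i = (1::nat) \<and> zs ! Suc i = 0}"
  have fin: "finite (?D zs)" for zs
    by (rule finite_subset[of _ "{..<length zs}"]) auto
  have "?D (x # y # xs) = (if x = 1 \<and> y = 0 then {0} else {}) \<union> Suc ` ?D (y # xs)"
    by (auto simp: set_eq_iff image_iff nth_Cons split: nat.splits if_splits)
  moreover have "card ((if x = 1 \<and> y = 0 then {0} else {}) \<union> Suc ` ?D (y # xs)) =
      of_bool (x = 1 \<and> y = 0) + card (?D (y # xs))"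
    using fin[of "y # xs"] by (subst card_Un_disjoint) (auto simp: card_image)
  ultimately show ?case
    using 1 by simp
qed auto

text \<open>Repeating the first letter at the end turns the wrap-around pair into an ordinary
  adjacent one.\<close>

lemma cdes_Cons: "cdes (x # u) = des (x # u @ [x])"
proof -
  have "(x # u) ! ((i + 1) mod length (x # u)) = (x # u @ [x]) ! Suc i"
    "(x # u) ! i = (x # u @ [x]) ! i" if "i < length (x # u)" for i
    using that by (cases "i = length u"; auto simp: nth_append nth_Cons')+
  then show ?thesis
    unfolding cdes_def des_eq_card by (intro arg_cong[of _ _ card]) auto
qed

lemma cdes_poly_Suc: "cdes_poly (Suc m) = des_poly 0 0 m (Suc m) + des_poly 1 1 (Suc m) m"
proof -
  have "balanced_words (Suc m) = content_words (Suc m) (Suc m)"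
    using length_content_words
    by (fastforce simp: balanced_words_def content_words_def)
  then have "cdes_poly (Suc m) =
      (\<Sum>w\<in>(#) 0 ` content_words m (Suc m) \<union> (#) 1 ` content_words (Suc m) m. monom 1 (cdes w))"
    by (simp add: cdes_poly_def content_words_rec)
  also have "\<dots> = (\<Sum>w\<in>(#) 0 ` content_words m (Suc m). monom 1 (cdes w)) +
      (\<Sum>w\<in>(#) 1 ` content_words (Suc m) m. monom 1 (cdes w))"
    by (intro sum.union_disjoint) auto
  also have "\<dots> = des_poly 0 0 m (Suc m) + des_poly 1 1 (Suc m) m"
    by (simp add: sum.reindex cdes_Cons des_poly_def)
  finally show ?thesis .
qed

text \<open>Words starting with \<open>0\<close> and words starting with \<open>1\<close> contribute
  the same product of binomials, hence the factor 2.\<close>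

lemma coeff_cdes_poly_Suc:
  "coeff (cdes_poly (Suc m)) 0 = 0"
  "coeff (cdes_poly (Suc m)) (Suc k) = 2 * real (Suc m choose Suc k) * real (m choose k)"
  by (simp_all add: cdes_poly_Suc coeff_des_poly_0 coeff_des_poly_1 del: binomial_Suc_Suc)

lemma degree_cdes_poly_Suc: "degree (cdes_poly (Suc m)) = Suc m"
proof (rule antisym)
  show "degree (cdes_poly (Suc m)) \<le> Suc m"
  proof (rule degree_le, intro allI impI)
    fix i assume "Suc m < i"
    then show "coeff (cdes_poly (Suc m)) i = 0"
      by (cases i) (auto simp: coeff_cdes_poly_Suc simp del: binomial_Suc_Suc)
  qed
  show "Suc m \<le> degree (cdes_poly (Suc m))"
    by (rule le_degree) (simp add: coeff_cdes_poly_Suc)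
qed

lemma poly_cdes_poly_Suc:
  "poly (cdes_poly (Suc m)) t =
     2 * (\<Sum>k\<le>m. real (Suc m choose Suc k) * real (m choose k) * t ^ Suc k)"
  by (simp add: poly_altdef degree_cdes_poly_Suc sum.atMost_Suc_shift coeff_cdes_poly_Suc
      sum_distrib_left mult.assoc del: binomial_Suc_Suc sum.atMost_Suc)

section \<open>Higher derivatives of polynomials\<close>

lemma higher_pderiv_mult:
  fixes p q :: "'a :: idom poly"
  shows "(pderiv ^^ n) (p * q) =
     (\<Sum>k\<le>n. of_nat (n choose k) * ((pderiv ^^ k) p * (pderiv ^^ (n - k)) q))"
proof (induction n arbitrary: p q)
  case 0
  then show ?case by simp
next
  case (Suc n)
  let ?f = "\<lambda>k. (pderiv ^^ k) p * (pderiv ^^ (Suc n - k)) q"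
  have "(pderiv ^^ Suc n) (p * q) = (pderiv ^^ n) (p * pderiv q) + (pderiv ^^ n) (pderiv p * q)"
    by (simp add: funpow_swap1 pderiv_mult higher_pderiv_add mult.commute)
  also have "(pderiv ^^ n) (p * pderiv q) = (\<Sum>k\<le>n. of_nat (n choose k) * ?f k)"
    unfolding Suc by (intro sum.cong) (auto simp: Suc_diff_le funpow_swap1)
  \<comment> \<open>The added term vanishes because \<open>n choose Suc n\<close> is 0. Splitting
    off index 0 then aligns this sum with the other one for Pascal's rule.\<close>
  also have "\<dots> = (\<Sum>k\<le>Suc n. of_nat (n choose k) * ?f k)"
    by (simp add: binomial_eq_0)
  also have "\<dots> = ?f 0 + (\<Sum>k\<le>n. of_nat (n choose Suc k) * ?f (Suc k))"
    by (simp add: sum.atMost_Suc_shift del: sum.atMost_Suc)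
  also have "(pderiv ^^ n) (pderiv p * q) = (\<Sum>k\<le>n. of_nat (n choose k) * ?f (Suc k))"
    unfolding Suc by (intro sum.cong) (auto simp: funpow_swap1)
  finally show ?case
    by (simp add: sum.atMost_Suc_shift sum.distrib algebra_simps del: sum.atMost_Suc)
qed

lemma higher_pderiv_linear_power:
  fixes c :: "'a :: field_char_0"
  assumes "k \<le> n"
  shows "(pderiv ^^ k) ([:c, 1:] ^ n) = smult (fact n / fact (n - k)) ([:c, 1:] ^ (n - k))"
  using assms
proof (induction k)
  case 0
  then show ?case by simp
next
  case (Suc k)
  then obtain j where "n - k = Suc j" "n - Suc k = j"
    by (metis Suc_diff_Suc Suc_le_lessD)
  with Suc show ?case
    by (simp add: pderiv_smult pderiv_power_Suc pderiv_pCons field_simps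
        del: power_Suc of_nat_Suc)
qed

text \<open>By the product rule each derivative costs at most one factor \<open>q\<close>. Once the
  truncated exponent \<open>n - k\<close> reaches 0 the claim is trivial.\<close>

lemma linear_power_dvd_higher_pderiv:
  fixes p q :: "'a :: idom poly"
  assumes "q ^ n dvd p"
  shows "q ^ (n - k) dvd (pderiv ^^ k) p"
proof (induction k)
  case 0
  then show ?case using assms by simp
next
  case (Suc k)
  show ?case
  proof (cases "n - k")
    case 0
    then have "n - Suc k = 0" by simp
    then show ?thesis by simp
  next
    case (Suc j)
    with Suc.IH obtain r where r: "(pderiv ^^ k) p = q ^ Suc j * r"
      by (auto elim: dvdE)
    have "q ^ j dvd pderiv (q ^ Suc j * r)"
      unfolding pderiv_mult pderiv_power_Suc
      by (intro dvd_add dvd_mult dvd_mult2 dvd_smult) (auto simp: le_imp_power_dvd)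
    with Suc r show ?thesis by (simp add: diff_Suc)
  qed
qed

text \<open>Inserting the roots in increasing order gives one new critical point per gap. The bounds
  by elements of \<open>S\<close> show that the new point is distinct from the earlier ones, and
  later confine the critical points to an interval.\<close>

lemma pderiv_roots_Rolle:
  fixes p :: "real poly"
  assumes "finite S" "\<forall>x\<in>S. poly p x = 0"
  shows "\<exists>T. finite T \<and> card T = card S - 1 \<and>
    (\<forall>t\<in>T. poly (pderiv p) t = 0 \<and> (\<exists>s\<in>S. s < t) \<and> (\<exists>s\<in>S. t < s))"
  using assms
proof (induction S rule: finite_linorder_max_induct)
  case empty
  then show ?case by auto
next
  case (insert b A)
  show ?case
  proof (cases "A = {}")
    case True
    then show ?thesis by auto
  next
    case False
    from insert obtain T where T: "finite T" "card T = card A - 1"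
      "\<forall>t\<in>T. poly (pderiv p) t = 0 \<and> (\<exists>s\<in>A. s < t) \<and> (\<exists>s\<in>A. t < s)" by auto
    have M: "Max A \<in> A" "Max A < b"
      using False insert by auto
    obtain c where c: "Max A < c" "c < b" "poly (pderiv p) c = 0"
      using poly_MVT[OF M(2), of p] insert.prems M by auto
    \<comment> \<open>Every point of \<open>T\<close> lies below some element of \<open>A\<close>,
      hence below \<open>Max A < c\<close>.\<close>
    have "c \<notin> T"
      using T(3) c(1) insert.hyps(1) by (meson Max_ge leD less_le_trans less_trans)
    moreover have "card A \<noteq> 0" "b \<notin> A"
      using False insert by auto
    ultimately have "card (insert c T) = card (insert b A) - 1"
      using T insert.hyps(1) by (simp del: card_eq_0_iff card_0_eq)
    then show ?thesis
      using T c M by (intro exI[of _ "insert c T"]) auto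
  qed
qed

section \<open>The Rodrigues formula\<close>

text \<open>The surplus factor \<open>[:0, 1:]\<close> survives \<open>m\<close> derivatives and
  accounts for the zero of the descent polynomial at the origin.\<close>

definition rodrigues :: "nat \<Rightarrow> real poly" where
  "rodrigues m = [:0, 1:] ^ Suc m * [:1, 1:] ^ m"

lemma poly_cdes_poly_rodrigues:
  assumes "x \<noteq> -1"
  shows "fact m * (1 + x) ^ Suc m * poly (cdes_poly (Suc m)) (x / (1 + x)) =
           2 * poly ((pderiv ^^ m) (rodrigues m)) x"
proof -
  have x: "1 + x \<noteq> 0"
    using assms by linarith
  have "poly ((pderiv ^^ m) (rodrigues m)) x =
      (\<Sum>k\<le>m. real (m choose k) * (poly ((pderiv ^^ (m - k)) ([:0, 1:] ^ Suc m)) x *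
        poly ((pderiv ^^ k) ([:1, 1:] ^ m)) x))"
    \<comment> \<open>The factors are swapped so that \<open>k\<close> counts the derivatives
      falling on the power of \<open>1 + x\<close>. The other factor then keeps
      \<open>x ^ Suc k\<close>, matching the exponent of \<open>t\<close>.\<close>
    unfolding rodrigues_def mult.commute[of "[:0, 1:] ^ Suc m"] higher_pderiv_mult poly_sum
    by (intro sum.cong) (auto simp: mult_ac of_nat_poly)
  also have "\<dots> = (\<Sum>k\<le>m. fact m * (1 + x) ^ Suc m *
      (real (Suc m choose Suc k) * real (m choose k) * (x / (1 + x)) ^ Suc k))"
  proof (intro sum.cong refl)
    fix k assume "k \<in> {..m}"
    then have k: "k \<le> m" by simp
    have diff: "Suc m - (m - k) = Suc k"
      using k by simp
    have "real (Suc m choose Suc k) = fact (Suc m) / (fact (Suc k) * fact (m - k))"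
      using k by (simp add: binomial_fact del: fact_Suc binomial_Suc_Suc)
    moreover have "(1 + x) ^ Suc m = (1 + x) ^ Suc k * (1 + x) ^ (m - k)"
      using k by (simp flip: power_add)
    then have "(1 + x) ^ Suc m * (x / (1 + x)) ^ Suc k = x ^ Suc k * (1 + x) ^ (m - k)"
      using x by (simp add: power_divide del: power_Suc)
    moreover have "poly ((pderiv ^^ (m - k)) ([:0, 1:] ^ Suc m)) x =
        fact (Suc m) / fact (Suc k) * x ^ Suc k"
      by (subst higher_pderiv_linear_power)
         (use k in \<open>simp_all add: diff del: power_Suc fact_Suc\<close>)
    moreover have "poly ((pderiv ^^ k) ([:1, 1:] ^ m)) x =
        fact m / fact (m - k) * (1 + x) ^ (m - k)"
      using k by (simp add: higher_pderiv_linear_power)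
    ultimately show "real (m choose k) * (poly ((pderiv ^^ (m - k)) ([:0, 1:] ^ Suc m)) x *
        poly ((pderiv ^^ k) ([:1, 1:] ^ m)) x) = fact m * (1 + x) ^ Suc m *
      (real (Suc m choose Suc k) * real (m choose k) * (x / (1 + x)) ^ Suc k)"
      by (simp add: mult_ac del: power_Suc fact_Suc binomial_Suc_Suc)
  qed
  also have "\<dots> = fact m * (1 + x) ^ Suc m * (poly (cdes_poly (Suc m)) (x / (1 + x)) / 2)"
    by (simp add: poly_cdes_poly_Suc del: power_Suc binomial_Suc_Suc flip: sum_distrib_left)
  finally show ?thesis
    by simp
qed

text \<open>While \<open>i < m\<close>, the points -1 and 0 are still zeros of the
  \<open>i\<close>-th derivative. With the \<open>i\<close> interior zeros they make
  \<open>i + 2\<close> points, and Rolle gives \<open>i + 1\<close> zeros strictly between -1 and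
  0.\<close>

lemma roots_higher_pderiv_rodrigues:
  assumes "i \<le> m"
  shows "\<exists>S. finite S \<and> card S = i \<and> S \<subseteq> {-1<..<0} \<and>
    (\<forall>x\<in>S. poly ((pderiv ^^ i) (rodrigues m)) x = 0)"
  using assms
proof (induction i)
  case 0
  then show ?case by auto
next
  case (Suc i)
  then obtain S where S: "finite S" "card S = i" "S \<subseteq> {-1<..<0}"
    "\<forall>x\<in>S. poly ((pderiv ^^ i) (rodrigues m)) x = 0" by auto
  have "[:0, 1:] ^ (Suc m - i) dvd (pderiv ^^ i) (rodrigues m)"
    unfolding rodrigues_def by (intro linear_power_dvd_higher_pderiv dvd_triv_left)
  then obtain q where "(pderiv ^^ i) (rodrigues m) = [:0, 1:] ^ (Suc m - i) * q" ..
  then have "poly ((pderiv ^^ i) (rodrigues m)) 0 = 0"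
    using Suc.prems by simp
  moreover have "[:1, 1:] ^ (m - i) dvd (pderiv ^^ i) (rodrigues m)"
    unfolding rodrigues_def by (intro linear_power_dvd_higher_pderiv dvd_triv_right)
  then obtain r where "(pderiv ^^ i) (rodrigues m) = [:1, 1:] ^ (m - i) * r" ..
  then have "poly ((pderiv ^^ i) (rodrigues m)) (-1) = 0"
    using Suc.prems by simp
  ultimately have "\<forall>x\<in>insert (-1) (insert 0 S). poly ((pderiv ^^ i) (rodrigues m)) x = 0"
    using S by auto
  from pderiv_roots_Rolle[OF _ this] S(1) obtain T where T: "finite T"
    "card T = card (insert (-1) (insert 0 S)) - 1"
    "\<forall>t\<in>T. poly (pderiv ((pderiv ^^ i) (rodrigues m))) t = 0 \<and>
      (\<exists>s\<in>insert (-1) (insert 0 S). s < t) \<and> (\<exists>s\<in>insert (-1) (insert 0 S). t < s)"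
    by blast
  have "0 \<notin> S" "-1 \<notin> S"
    using S(3) by auto
  then have "card T = Suc i"
    using T(2) S by simp
  moreover have "T \<subseteq> {-1<..<0}"
    using T(3) S(3) by fastforce
  ultimately show ?case
    using T by (intro exI[of _ T]) auto
qed

lemma negative_roots_cdes_poly_Suc:
  "\<exists>Z. finite Z \<and> card Z = m \<and> (\<forall>z\<in>Z. z < 0 \<and> poly (cdes_poly (Suc m)) z = 0)"
proof -
  obtain S where S: "finite S" "card S = m" "S \<subseteq> {-1<..<0}"
    "\<forall>x\<in>S. poly ((pderiv ^^ m) (rodrigues m)) x = 0"
    using roots_higher_pderiv_rodrigues[of m m] by auto
  have "inj_on (\<lambda>x. x / (1 + x)) S"
  proof (rule inj_onI)
    fix x y assume "x \<in> S" "y \<in> S" and eq: "x / (1 + x) = y / (1 + y)"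
    then have "1 + x \<noteq> 0" "1 + y \<noteq> 0"
      using S(3) by force+
    with eq have "x * (1 + y) = y * (1 + x)"
      by (simp add: frac_eq_eq)
    then show "x = y"
      by (simp add: algebra_simps)
  qed
  \<comment> \<open>Since \<open>1 + x > 0\<close>, the prefactor in
    \<open>poly_cdes_poly_rodrigues\<close> is nonzero, so zeros carry over.\<close>
  moreover have "x / (1 + x) < 0 \<and> poly (cdes_poly (Suc m)) (x / (1 + x)) = 0" if "x \<in> S" for x
  proof -
    have x: "-1 < x" "x < 0"
      using that S(3) by auto
    then show ?thesis
      using poly_cdes_poly_rodrigues[of x m] S(4) that by (auto simp: divide_simps)
  qed
  ultimately show ?thesis
    using S by (intro exI[of _ "(\<lambda>x. x / (1 + x)) ` S"]) (auto simp: card_image)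
qed

section \<open>Polynomials with as many roots as their degree\<close>

text \<open>The multiset of roots contains each element of \<open>R\<close> and has size at most
  \<open>degree p = card R\<close>. It is therefore exactly \<open>mset_set R\<close>, in which all
  multiplicities are 1.\<close>

lemma order_eq_1_if_card_roots_eq_degree:
  fixes p :: "'a :: idom poly"
  assumes "p \<noteq> 0" "finite R" "card R = degree p" "\<forall>r\<in>R. poly p r = 0" "x \<in> R"
  shows "order x p = 1"
proof -
  have "mset_set R \<subseteq># proots p"
    using assms by (auto simp: subseteq_mset_def count_mset_set' order_root Suc_le_eq)
  moreover have "size (proots p) \<le> size (mset_set R)"
    using size_proots_le[of p] assms by simp
  ultimately have "proots p = mset_set R"
    by (metis mset_subset_size subset_mset.le_imp_less_or_eq leD)
  then show ?thesis
    using assms by (metis count_proots count_mset_set(1))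
qed

lemma roots_eq_if_card_roots_eq_degree:
  fixes p :: "'a :: {idom,ring_char_0} poly"
  assumes "p \<noteq> 0" "card R = degree p" "\<forall>r\<in>R. poly p r = 0"
  shows "{z. poly p z = 0} = R"
proof (rule sym, rule card_seteq)
  show "finite {z. poly p z = 0}"
    using assms(1) by (rule poly_roots_finite)
  show "card {z. poly p z = 0} \<le> card R"
    using card_poly_roots_bound[OF assms(1)] assms(2) by simp
qed (use assms in auto)

lemma poly_map_poly_of_real:
  "poly (map_poly complex_of_real p) (complex_of_real x) = complex_of_real (poly p x)"
  by (simp add: poly_altdef degree_map_poly coeff_map_poly)

theorem theorem3p1:
  fixes n :: nat
  assumes "n \<ge> 1"
  shows "order 0 (cdes_poly n) = 1 \<and>
    (\<exists>Z :: real set. finite Z \<and> card Z = n - 1 \<and>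
       (\<forall>x\<in>Z. x < 0 \<and> order x (cdes_poly n) = 1) \<and>
       {z :: complex. poly (map_poly complex_of_real (cdes_poly n)) z = 0}
         = insert 0 (complex_of_real ` Z))"
proof -
  obtain m where n: "n = Suc m"
    using assms by (cases n) auto
  let ?p = "cdes_poly n"
  obtain Z where Z: "finite Z" "card Z = m" "\<forall>z\<in>Z. z < 0 \<and> poly ?p z = 0"
    using negative_roots_cdes_poly_Suc[of m] n by auto
  have deg: "degree ?p = n"
    using degree_cdes_poly_Suc n by simp
  then have p0: "?p \<noteq> 0"
    using n by auto
  have card: "card (insert 0 Z) = n"
    using Z n by (subst card_insert_disjoint) auto
  have roots: "\<forall>z\<in>insert 0 Z. poly ?p z = 0"
    using Z(3) by (auto simp: n poly_0_coeff_0 coeff_cdes_poly_Suc)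
  have ord: "order x ?p = 1" if "x \<in> insert 0 Z" for x
    using order_eq_1_if_card_roots_eq_degree[OF p0 _ _ roots that] Z(1) card deg by simp
  \<comment> \<open>Counting against the degree over the complex numbers excludes nonreal zeros: the
    \<open>n\<close> real ones stay distinct under the embedding, which preserves the
    degree.\<close>
  have "{z. poly (map_poly complex_of_real ?p) z = 0} = complex_of_real ` insert 0 Z"
  proof (rule roots_eq_if_card_roots_eq_degree)
    show "map_poly complex_of_real ?p \<noteq> 0"
      using p0 by (simp add: map_poly_eq_0_iff)
    show "card (complex_of_real ` insert 0 Z) = degree (map_poly complex_of_real ?p)"
      using card deg by (subst card_image) (auto simp: degree_map_poly inj_on_def)
    show "\<forall>r\<in>complex_of_real ` insert 0 Z. poly (map_poly complex_of_real ?p) r = 0"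
      using roots by (metis imageE of_real_0 poly_map_poly_of_real)
  qed
  then show ?thesis
    using Z ord n by (intro conjI exI[of _ Z]) auto
qed

end
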